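(* Let $(M;c)$ be a connected modular coloured matroid with $r(M)\ge3$. Then $(M;c)$ is a target if and only if $(M|P;\,c|P)$ is a target for every plane $P$ of $M$.
   Context: A coloured matroid $(M;c)$ is a (finite) matroid $M$ with a function $c$ on $E(M)$. $M$ is modular if $r_M(F)+r_M(F')=r_M(F\cup F')+r_M(F\cap F')$ for all flats $F,F'$. A plane is a rank-three flat. $(M;c)$ is a target if there are flats $\mathrm{cl}_M(\varnothing)=F_0\subseteq F_1\subseteq\dots\subseteq F_k=E(M)$ such that every nonempty set among $F_0$ and the sets $F_{i+1}-F_i$ is monochromatic under $c$. *)

theory Defs
  imports "HOL-Library.FuncSet"
begin

record 'a set_system =
  ground :: "'a set"
  indep :: "'a set \<Rightarrow> bool"

definition matroid :: "'a set_system \<Rightarrow> bool" where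
  "matroid M \<longleftrightarrow>
     finite (ground M) \<and>
     (\<forall>X. indep M X \<longrightarrow> X \<subseteq> ground M) \<and>
     indep M {} \<and>
     (\<forall>X Y. indep M X \<and> Y \<subseteq> X \<longrightarrow> indep M Y) \<and>
     (\<forall>X Y. indep M X \<and> indep M Y \<and> card X < card Y \<longrightarrow>
        (\<exists>y\<in>Y - X. indep M (insert y X)))"

definition matroid_rank :: "'a set_system \<Rightarrow> 'a set \<Rightarrow> nat" where
  "matroid_rank M A = Max (card ` {X. X \<subseteq> A \<and> indep M X})"

definition matroid_cl :: "'a set_system \<Rightarrow> 'a set \<Rightarrow> 'a set" where
  "matroid_cl M A = {x \<in> ground M. matroid_rank M (insert x A) = matroid_rank M A}"

definition matroid_flat :: "'a set_system \<Rightarrow> 'a set \<Rightarrow> bool" where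
  "matroid_flat M F \<longleftrightarrow> F \<subseteq> ground M \<and> matroid_cl M F = F"

definition matroid_plane :: "'a set_system \<Rightarrow> 'a set \<Rightarrow> bool" where
  "matroid_plane M P \<longleftrightarrow> matroid_flat M P \<and> matroid_rank M P = 3"

definition matroid_circuit :: "'a set_system \<Rightarrow> 'a set \<Rightarrow> bool" where
  "matroid_circuit M C \<longleftrightarrow>
     C \<subseteq> ground M \<and> \<not> indep M C \<and> (\<forall>D. D \<subset> C \<longrightarrow> indep M D)"

definition matroid_connected :: "'a set_system \<Rightarrow> bool" where
  "matroid_connected M \<longleftrightarrow>
     (\<forall>e\<in>ground M. \<forall>f\<in>ground M. e \<noteq> f \<longrightarrow>
        (\<exists>C. matroid_circuit M C \<and> e \<in> C \<and> f \<in> C))"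

definition matroid_modular :: "'a set_system \<Rightarrow> bool" where
  "matroid_modular M \<longleftrightarrow>
     (\<forall>F F'. matroid_flat M F \<and> matroid_flat M F' \<longrightarrow>
        matroid_rank M F + matroid_rank M F' =
        matroid_rank M (F \<union> F') + matroid_rank M (F \<inter> F'))"

definition matroid_restrict :: "'a set_system \<Rightarrow> 'a set \<Rightarrow> 'a set_system" where
  "matroid_restrict M X = \<lparr>ground = X, indep = (\<lambda>Y. Y \<subseteq> X \<and> indep M Y)\<rparr>"

definition monochromatic :: "('a \<Rightarrow> 'c) \<Rightarrow> 'a set \<Rightarrow> bool" where
  "monochromatic c X \<longleftrightarrow> (\<exists>a. \<forall>x\<in>X. c x = a)"

text \<open>A colouring is a total function of which only the values on \<open>ground M\<close> matter.\<close>

definition target :: "'a set_system \<Rightarrow> ('a \<Rightarrow> 'c) \<Rightarrow> bool" where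
  "target M c \<longleftrightarrow>
     (\<exists>(k::nat) F.
        (\<forall>i\<le>k. matroid_flat M (F i)) \<and>
        F 0 = matroid_cl M {} \<and>
        F k = ground M \<and>
        (\<forall>i<k. F i \<subseteq> F (Suc i)) \<and>
        (F 0 \<noteq> {} \<longrightarrow> monochromatic c (F 0)) \<and>
        (\<forall>i<k. F (Suc i) - F i \<noteq> {} \<longrightarrow> monochromatic c (F (Suc i) - F i)))"

lemma matroid_restrict:
  assumes "matroid M" and "X \<subseteq> ground M"
  shows "matroid (matroid_restrict M X)"
proof -
  have fin: "finite X"
    using assms finite_subset by (auto simp: matroid_def)
  have sub: "indep M B" if "indep M A" "B \<subseteq> A" for A B
    using assms(1) that unfolding matroid_def by metis
  have empty: "indep M {}"
    using assms(1) unfolding matroid_def by metis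
  have aug: "\<exists>y\<in>B - A. indep M (insert y A)"
    if "indep M A" "indep M B" "card A < card B" for A B
    using assms(1) that unfolding matroid_def by metis
  have aug': "\<exists>y\<in>B - A. insert y A \<subseteq> X \<and> indep M (insert y A)"
    if "A \<subseteq> X" "B \<subseteq> X" "indep M A" "indep M B" "card A < card B" for A B
  proof -
    from aug[OF that(3-5)] obtain y where "y \<in> B - A" "indep M (insert y A)" ..
    then show ?thesis using that(1,2) by (intro bexI[of _ y]) auto
  qed
  let ?N = "matroid_restrict M X"
  have [simp]: "ground ?N = X" "\<And>Y. indep ?N Y \<longleftrightarrow> Y \<subseteq> X \<and> indep M Y"
    by (simp_all add: matroid_restrict_def)
  show ?thesis
    unfolding matroid_def
  proof (intro conjI allI impI)
    fix A B assume "indep ?N A \<and> B \<subseteq> A"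
    then show "indep ?N B" using sub[of A B] by auto
  next
    fix A B assume "indep ?N A \<and> indep ?N B \<and> card A < card B"
    then show "\<exists>y\<in>B - A. indep ?N (insert y A)" using aug'[of A B] by simp
  qed (use fin empty in simp_all)
qed

end

(*
Call a flat F peelable if some proper flat G leaves F - G monochromatic; in a loopless matroid,
being a target means that every nonempty flat is peelable. Connectedness and modularity make M a
projective geometry with at least three points on every line, so it suffices to peel a flat F of
rank at least 4 whose smaller flats are peelable. Let H be a hyperplane of F, with H - K of colour a.
If neither H nor any cl (K + y) peels F, there are y, z in F - H, not of colour a, whose line L
meets H in a point p outside K. Peelability of L gives y and z the same colour b. Each plane P
through L has either P - L of colour a or P - H of colour b; the union W of L and the planes of the
second kind is a flat, so either W (if W is proper) or H peels F.
*)
theory Submission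
  imports Defs
begin

section \<open>Rank, closure and flats of a finite matroid\<close>

locale finite_matroid =
  fixes M :: "'a set_system"
  assumes matroid: "matroid M"
begin

abbreviation "E \<equiv> ground M"
abbreviation "ind \<equiv> indep M"
abbreviation "r \<equiv> matroid_rank M"
abbreviation "cl \<equiv> matroid_cl M"
abbreviation "flat \<equiv> matroid_flat M"

lemma finite_E: "finite E"
  using matroid unfolding matroid_def by blast

lemma ind_ground: "ind X \<Longrightarrow> X \<subseteq> E"
  using matroid unfolding matroid_def by blast

lemma ind_empty: "ind {}"
  using matroid unfolding matroid_def by blast

lemma ind_subset: "ind X \<Longrightarrow> Y \<subseteq> X \<Longrightarrow> ind Y"
  using matroid unfolding matroid_def by metis

lemma ind_augment:
  "ind X \<Longrightarrow> ind Y \<Longrightarrow> card X < card Y \<Longrightarrow> \<exists>y\<in>Y - X. ind (insert y X)"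
  using matroid unfolding matroid_def by metis

lemma ind_finite: "ind X \<Longrightarrow> finite X"
  using ind_ground finite_E finite_subset by blast

lemma finite_ind: "finite {X. X \<subseteq> A \<and> ind X}"
  by (rule finite_subset[of _ "Pow E"]) (use ind_ground finite_E in auto)

lemma card_le_rank: "ind X \<Longrightarrow> X \<subseteq> A \<Longrightarrow> card X \<le> r A"
  unfolding matroid_rank_def using finite_ind by (intro Max_ge) auto

lemma basis_ex: "\<exists>B\<subseteq>A. ind B \<and> card B = r A"
proof -
  have "r A \<in> card ` {X. X \<subseteq> A \<and> ind X}"
    unfolding matroid_rank_def using finite_ind ind_empty by (intro Max_in) auto
  then show ?thesis by auto
qed

lemma rank_mono: "A \<subseteq> B \<Longrightarrow> r A \<le> r B"
  using basis_ex[of A] card_le_rank[of _ B] by (metis subset_trans)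

lemma basis_extend:
  "ind X \<Longrightarrow> X \<subseteq> A \<Longrightarrow> \<exists>B. X \<subseteq> B \<and> B \<subseteq> A \<and> ind B \<and> card B = r A"
proof (induction "r A - card X" arbitrary: X rule: less_induct)
  case less
  show ?case
  proof (cases "card X = r A")
    case False
    then have lt: "card X < r A" using card_le_rank[OF less.prems] by simp
    obtain B where B: "B \<subseteq> A" "ind B" "card B = r A" using basis_ex by blast
    then obtain y where y: "y \<in> B - X" "ind (insert y X)"
      using ind_augment[OF less.prems(1) B(2)] lt by auto
    have "card (insert y X) = Suc (card X)"
      using y ind_finite[OF less.prems(1)] by simp
    then have "r A - card (insert y X) < r A - card X" using lt by simp
    from less.hyps[OF this y(2)] show ?thesis using y B less.prems by auto
  qed (use less.prems in blast)
qed

lemma rank_insert_le: "r (insert x A) \<le> Suc (r A)"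
proof -
  obtain B where B: "B \<subseteq> insert x A" "ind B" "card B = r (insert x A)"
    using basis_ex by blast
  have "card (B - {x}) \<le> r A"
    using B by (intro card_le_rank) (auto intro: ind_subset)
  moreover have "card B \<le> Suc (card (B - {x}))" by (cases "x \<in> B") (simp_all add: card_Diff_singleton)
  ultimately show ?thesis using B by simp
qed

text \<open>Extend a basis \<open>X\<close> of \<open>A\<close> to a basis of \<open>B\<close> and
  then to one of \<open>insert x B\<close>. If the last step adds anything it adds \<open>x\<close>,
  and then \<open>insert x X\<close> is independent and too large for
  \<open>insert x A\<close>.\<close>

lemma rank_insert_eq_mono:
  assumes "r (insert x A) = r A" "A \<subseteq> B"
  shows "r (insert x B) = r B"
proof (rule ccontr)
  assume ne: "r (insert x B) \<noteq> r B"
  then have xB: "x \<notin> B" by (auto simp: insert_absorb)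
  have lt: "r B < r (insert x B)" using ne rank_mono[OF subset_insertI[of B x]] by linarith
  obtain X where X: "X \<subseteq> A" "ind X" "card X = r A" using basis_ex by blast
  obtain Y where Y: "X \<subseteq> Y" "Y \<subseteq> B" "ind Y" "card Y = r B"
    using basis_extend[of X B] X assms(2) by blast
  obtain Z where Z: "Y \<subseteq> Z" "Z \<subseteq> insert x B" "ind Z" "card Z = r (insert x B)"
    using basis_extend[of Y "insert x B"] Y by blast
  have "\<not> Z \<subseteq> B" using Z card_le_rank[of Z B] lt by auto
  then have "x \<in> Z" using Z by blast
  then have "ind (insert x X)" using Z Y by (auto intro: ind_subset)
  then have "card (insert x X) \<le> r (insert x A)"
    using X by (intro card_le_rank) auto
  moreover have "card (insert x X) = Suc (card X)"
    using X xB assms(2) ind_finite by (subst card_insert_disjoint) auto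
  ultimately show False using assms(1) X by simp
qed

lemma rank_Un_eq:
  assumes "finite S" "\<And>x. x \<in> S \<Longrightarrow> r (insert x A) = r A"
  shows "r (A \<union> S) = r A"
  using assms
proof (induction S)
  case (insert x S)
  have "r (insert x (A \<union> S)) = r (A \<union> S)"
    by (rule rank_insert_eq_mono[of x A]) (use insert.prems in auto)
  then show ?case using insert by simp
qed simp

lemma cl_ground: "cl A \<subseteq> E"
  unfolding matroid_cl_def by blast

lemma in_cl_ground: "x \<in> cl A \<Longrightarrow> x \<in> E"
  using cl_ground by blast

lemma cl_superset: "A \<subseteq> E \<Longrightarrow> A \<subseteq> cl A"
  unfolding matroid_cl_def by (auto simp: insert_absorb)

lemma cl_mono: "A \<subseteq> B \<Longrightarrow> cl A \<subseteq> cl B"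
  unfolding matroid_cl_def using rank_insert_eq_mono by blast

lemma rank_empty: "r {} = 0"
  using basis_ex[of "{}"] by force

lemma rank_insert: "x \<in> E \<Longrightarrow> r (insert x A) = (if x \<in> cl A then r A else Suc (r A))"
  using rank_insert_le[of x A] rank_mono[OF subset_insertI[of A x]]
  unfolding matroid_cl_def by auto

lemma rank_Un_cl: "r (A \<union> cl A) = r A"
proof (rule rank_Un_eq)
  show "finite (cl A)" using cl_ground finite_E by (rule finite_subset)
qed (simp add: matroid_cl_def)

lemma cl_cl: "cl (cl A) \<subseteq> cl A"
proof
  fix x assume x: "x \<in> cl (cl A)"
  then have "r (insert x (cl A)) = r (cl A)" by (simp add: matroid_cl_def[of M "cl A"])
  then have "r (insert x (A \<union> cl A)) = r (A \<union> cl A)" by (rule rank_insert_eq_mono) simp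
  moreover have "r (insert x A) \<le> r (insert x (A \<union> cl A))" by (rule rank_mono) auto
  ultimately have "r (insert x A) = r A"
    using rank_Un_cl[of A] rank_mono[OF subset_insertI[of A x]] by linarith
  then show "x \<in> cl A" using in_cl_ground[OF x] by (simp add: matroid_cl_def)
qed

lemma rank_cl: "A \<subseteq> E \<Longrightarrow> r (cl A) = r A"
  using rank_Un_cl[of A] cl_superset[of A] by (simp add: Un_absorb1)

lemma flat_cl: "flat (cl A)"
  unfolding matroid_flat_def using cl_ground cl_cl cl_superset by blast

lemma flat_ground: "flat F \<Longrightarrow> F \<subseteq> E"
  unfolding matroid_flat_def by blast

lemma flat_E: "flat E"
  unfolding matroid_flat_def using cl_ground cl_superset by blast

lemma cl_subset_flat: "flat F \<Longrightarrow> A \<subseteq> F \<Longrightarrow> cl A \<subseteq> F"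
  unfolding matroid_flat_def using cl_mono by blast

lemma in_cl_flat: "x \<in> cl A \<Longrightarrow> flat F \<Longrightarrow> A \<subseteq> F \<Longrightarrow> x \<in> F"
  using cl_subset_flat by blast

lemma in_cl_cl: "x \<in> cl A \<Longrightarrow> A \<subseteq> cl B \<Longrightarrow> x \<in> cl B"
  using cl_subset_flat[OF flat_cl] by blast

lemma flat_Int: "flat F \<Longrightarrow> flat G \<Longrightarrow> flat (F \<inter> G)"
  unfolding matroid_flat_def using cl_mono[of "F \<inter> G"] cl_superset[of "F \<inter> G"] by blast

lemma flat_eqI:
  assumes "flat G" "flat F" "G \<subseteq> F" "r F \<le> r G"
  shows "G = F"
proof
  show "F \<subseteq> G"
  proof
    fix x assume "x \<in> F"
    then have "r (insert x G) \<le> r F" using assms(3) by (intro rank_mono) auto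
    then have "r (insert x G) = r G" using assms(4) rank_mono[OF subset_insertI[of G x]] by linarith
    then have "x \<in> cl G" using \<open>x \<in> F\<close> flat_ground[OF assms(2)] by (auto simp: matroid_cl_def)
    then show "x \<in> G" using assms(1) by (simp add: matroid_flat_def)
  qed
qed (rule assms(3))

lemma flat_psubset_rank: "flat G \<Longrightarrow> flat F \<Longrightarrow> G \<subset> F \<Longrightarrow> r G < r F"
  using flat_eqI[of G F] by (metis not_le psubsetE subset_refl)

text \<open>Mac Lane-Steinitz exchange: adding \<open>x\<close> and \<open>y\<close> to
  \<open>A\<close> raises the rank by at most one, and adding \<open>x\<close> alone already does
  so.\<close>

lemma cl_exchange:
  assumes "x \<in> cl (insert y A)" "x \<notin> cl A" "y \<in> E"
  shows "y \<in> cl (insert x A)"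
proof -
  have x: "x \<in> E" using assms(1) by (rule in_cl_ground)
  have "r (insert x (insert y A)) = r (insert y A)"
    using assms(1) by (simp add: matroid_cl_def)
  then have "r (insert y (insert x A)) \<le> Suc (r A)"
    using rank_insert_le[of y A] by (simp add: insert_commute)
  moreover have "r (insert x A) = Suc (r A)" using rank_insert[OF x] assms(2) by simp
  ultimately have "r (insert y (insert x A)) = r (insert x A)"
    using rank_mono[OF subset_insertI[of "insert x A" y]] by linarith
  then show ?thesis using assms(3) by (simp add: matroid_cl_def)
qed

lemma rank_ind: "ind X \<Longrightarrow> r X = card X"
proof -
  assume X: "ind X"
  obtain B where "B \<subseteq> X" "card B = r X" using basis_ex by blast
  then show "r X = card X"
    using card_le_rank[OF X subset_refl] card_mono[OF ind_finite[OF X], of B] by simp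
qed

lemma hyperplane_ex:
  assumes "flat F" "0 < r F"
  shows "\<exists>H. flat H \<and> H \<subset> F \<and> Suc (r H) = r F"
proof -
  obtain B where B: "B \<subseteq> F" "ind B" "card B = r F" using basis_ex by blast
  then obtain e where e: "e \<in> B" using assms(2) by fastforce
  have "r (B - {e}) = card (B - {e})" using B by (intro rank_ind) (auto intro: ind_subset)
  then have *: "r (cl (B - {e})) = card B - 1"
    using e ind_ground[OF B(2)] ind_finite[OF B(2)] by (subst rank_cl) auto
  have "cl (B - {e}) \<subseteq> F" using assms(1) B by (intro cl_subset_flat) auto
  moreover have "cl (B - {e}) \<noteq> F" using * B assms(2) by auto
  ultimately show ?thesis using flat_cl[of "B - {e}"] * B assms(2) by (intro exI[of _ "cl (B - {e})"]) auto
qed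

section \<open>Targets and peelable flats\<close>

definition peelable :: "('a \<Rightarrow> 'c) \<Rightarrow> 'a set \<Rightarrow> bool" where
  "peelable c F \<longleftrightarrow> (\<exists>G. flat G \<and> G \<subset> F \<and> monochromatic c (F - G))"

text \<open>Given a chain, let \<open>C i\<close> be its first member containing \<open>F\<close>;
  the flat before it, cut down to \<open>F\<close>, peels \<open>F\<close>, and \<open>i\<close> is
  not 0 because \<open>C 0 = cl {}\<close> is empty. Conversely, peeling repeatedly from the ground
  set down to the empty flat lists a chain in reverse.\<close>

lemma target_iff_peelable:
  assumes loopless: "cl {} = {}"
  shows "target M c \<longleftrightarrow> (\<forall>F. flat F \<and> F \<noteq> {} \<longrightarrow> peelable c F)"
proof (intro iffI allI impI; (elim conjE)?)
  fix F assume "target M c" and F: "flat F" "F \<noteq> {}"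
  then obtain k C where C: "\<forall>i\<le>k. flat (C i)" "C 0 = {}" "C k = E"
      "\<forall>i<k. C (Suc i) - C i \<noteq> {} \<longrightarrow> monochromatic c (C (Suc i) - C i)"
    unfolding target_def loopless by auto
  define i where "i = (LEAST i. F \<subseteq> C i)"
  have Fk: "F \<subseteq> C k" using C(3) flat_ground[OF F(1)] by simp
  have Fi: "F \<subseteq> C i" unfolding i_def using Fk by (rule LeastI)
  have ik: "i \<le> k" unfolding i_def using Fk by (rule Least_le)
  have "i \<noteq> 0" using Fi C(2) F(2) by (metis subset_empty)
  then obtain j where j: "i = Suc j" using not0_implies_Suc by blast
  have Fj: "\<not> F \<subseteq> C j" using j not_less_Least[of j "\<lambda>i. F \<subseteq> C i"] unfolding i_def by simp
  then have "monochromatic c (C (Suc j) - C j)" using C(4) Fi j ik by auto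
  then have "monochromatic c (F - F \<inter> C j)" using Fi j unfolding monochromatic_def by blast
  moreover have "flat (F \<inter> C j)" using flat_Int F(1) C(1) ik j by simp
  ultimately show "peelable c F" unfolding peelable_def using Fj by blast
next
  assume peel: "\<forall>F. flat F \<and> F \<noteq> {} \<longrightarrow> peelable c F"
  \<comment> \<open>For the induction the chain ends at an arbitrary flat \<open>F\<close> in place
    of \<open>E\<close>; a flat \<open>G\<close> that peels \<open>F\<close> has a chain, to which
    \<open>F\<close> is appended.\<close>
  have "\<exists>k C. (\<forall>i\<le>k. flat (C i)) \<and> C 0 = {} \<and> C k = F \<and> (\<forall>i<k. C i \<subseteq> C (Suc i))
      \<and> (\<forall>i<k. monochromatic c (C (Suc i) - C i))" if "flat F" for F
    using finite_subset[OF flat_ground[OF that] finite_E] that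
  proof (induction F rule: finite_psubset_induct)
    case (psubset F)
    show ?case
    proof (cases "F = {}")
      case True
      then show ?thesis using psubset.prems by (intro exI[of _ 0] exI[of _ "\<lambda>_. {}"]) auto
    next
      case False
      then obtain G where G: "flat G" "G \<subset> F" "monochromatic c (F - G)"
        using peel psubset.prems unfolding peelable_def by blast
      from psubset.IH[OF G(2,1)] obtain k C where C: "\<forall>i\<le>k. flat (C i)" "C 0 = {}" "C k = G"
          "\<forall>i<k. C i \<subseteq> C (Suc i)" "\<forall>i<k. monochromatic c (C (Suc i) - C i)" by blast
      show ?thesis
        by (intro exI[of _ "Suc k"] exI[of _ "C(Suc k := F)"])
          (use C G psubset.prems in \<open>auto simp: less_Suc_eq le_Suc_eq\<close>)
    qed
  qed
  from this[OF flat_E] obtain k C where "\<forall>i\<le>k. flat (C i)" "C 0 = {}" "C k = E"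
      "\<forall>i<k. C i \<subseteq> C (Suc i)" "\<forall>i<k. monochromatic c (C (Suc i) - C i)" by blast
  then show "target M c" unfolding target_def loopless
    by (intro exI[of _ k] exI[of _ C]) simp
qed

section \<open>Restriction to a flat\<close>

lemma rank_restrict:
  assumes "A \<subseteq> P"
  shows "matroid_rank (matroid_restrict M P) A = r A"
proof -
  have "{X. X \<subseteq> A \<and> X \<subseteq> P \<and> ind X} = {X. X \<subseteq> A \<and> ind X}" using assms by auto
  then show ?thesis by (simp add: matroid_rank_def matroid_restrict_def)
qed

lemma cl_restrict:
  assumes "flat P" "A \<subseteq> P"
  shows "matroid_cl (matroid_restrict M P) A = cl A"
proof -
  have "matroid_cl (matroid_restrict M P) A = {x \<in> P. r (insert x A) = r A}"
    using assms(2) rank_restrict[of _ P]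
    by (auto simp: matroid_cl_def[of "matroid_restrict M P"]) (auto simp: matroid_restrict_def)
  also have "\<dots> = cl A"
    using cl_subset_flat[OF assms] flat_ground[OF assms(1)] unfolding matroid_cl_def by blast
  finally show ?thesis .
qed

lemma flat_restrict:
  assumes "flat P"
  shows "matroid_flat (matroid_restrict M P) F \<longleftrightarrow> F \<subseteq> P \<and> flat F"
proof -
  have "ground (matroid_restrict M P) = P" by (simp add: matroid_restrict_def)
  then show ?thesis
    unfolding matroid_flat_def using cl_restrict[OF assms, of F] flat_ground[OF assms] by auto
qed

text \<open>The flats of the restriction are the flats of \<open>M\<close> inside \<open>P\<close>,
  and the two colourings agree on \<open>P\<close>, so peelability means the same in both
  matroids.\<close>

lemma target_restrict_iff_peelable:
  assumes loopless: "cl {} = {}" and P: "flat P"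
  shows "target (matroid_restrict M P) (restrict c P) \<longleftrightarrow>
    (\<forall>F. flat F \<and> F \<noteq> {} \<and> F \<subseteq> P \<longrightarrow> peelable c F)"
proof -
  interpret N: finite_matroid "matroid_restrict M P"
    by unfold_locales (rule matroid_restrict[OF matroid flat_ground[OF P]])
  have mono: "monochromatic (restrict c P) (F - G) \<longleftrightarrow> monochromatic c (F - G)"
    if "F \<subseteq> P" for F G
    using that unfolding monochromatic_def by (metis DiffD1 restrict_apply' subsetD)
  have "N.peelable (restrict c P) F \<longleftrightarrow> peelable c F" if "F \<subseteq> P" for F
    unfolding N.peelable_def peelable_def flat_restrict[OF P] mono[OF that] using that by blast
  moreover have "matroid_cl (matroid_restrict M P) {} = {}"
    using cl_restrict[OF P, of "{}"] loopless by simp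
  ultimately show ?thesis
    using N.target_iff_peelable[of "restrict c P"] unfolding flat_restrict[OF P] by blast
qed

text \<open>By modularity \<open>cl A\<close> and \<open>cl B\<close> intersect in a flat of
  positive rank, hence in a nonempty set. This is the source of all intersection points
  below.\<close>

lemma modular_meet:
  assumes "matroid_modular M" "A \<subseteq> E" "B \<subseteq> E" "r (A \<union> B) < r A + r B"
  shows "\<exists>u. u \<in> cl A \<and> u \<in> cl B"
proof -
  have "r (cl A \<union> cl B) \<le> r (cl (A \<union> B))" by (intro rank_mono) (simp add: cl_mono)
  also have "\<dots> = r (A \<union> B)" using assms by (intro rank_cl) simp
  finally have "r (cl A \<union> cl B) \<le> r (A \<union> B)" .
  moreover have "r (cl A) + r (cl B) = r (cl A \<union> cl B) + r (cl A \<inter> cl B)"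
    using assms(1) flat_cl unfolding matroid_modular_def by blast
  ultimately have "r (cl A \<inter> cl B) \<noteq> 0" using assms rank_cl by simp
  then have "cl A \<inter> cl B \<noteq> {}" using rank_empty by metis
  then show ?thesis by blast
qed

end

section \<open>Projective geometries\<close>

text \<open>Parallel elements are allowed, so the points of the geometry are the rank-one flats;
  distinctness of points therefore reads \<open>u \<notin> cl {v}\<close>.\<close>

locale projective_matroid = finite_matroid +
  assumes loopless: "cl {} = {}"
    and modular: "matroid_modular M"
    and third_point: "\<lbrakk>u \<in> E; v \<in> E; u \<notin> cl {v}\<rbrakk> \<Longrightarrow> \<exists>m\<in>cl {u, v}. m \<notin> cl {u} \<and> m \<notin> cl {v}"
begin

lemma rank_singleton: "x \<in> E \<Longrightarrow> r {x} = 1"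
  using rank_insert[of x "{}"] loopless rank_empty by simp

lemma rank_pair: "x \<in> E \<Longrightarrow> y \<in> E \<Longrightarrow> x \<notin> cl {y} \<Longrightarrow> r {x, y} = 2"
  using rank_insert[of x "{y}"] rank_singleton by simp

lemma cl_singleton_sym: "x \<in> cl {y} \<Longrightarrow> y \<in> E \<Longrightarrow> y \<in> cl {x}"
  using cl_exchange[of x y "{}"] loopless by simp

lemmas meet = modular_meet[OF modular]

text \<open>The subspaces of a projective space are its line-closed sets. By induction on a finite
  \<open>A\<close>, a point \<open>z\<close> of \<open>cl (insert x A)\<close> lies on a line
  through \<open>x\<close> and some point \<open>u\<close> of \<open>cl A\<close>.\<close>

lemma flat_if_closed_under_lines:
  assumes W: "W \<subseteq> E" and lines: "\<And>x y. x \<in> W \<Longrightarrow> y \<in> W \<Longrightarrow> cl {x, y} \<subseteq> W"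
  shows "flat W"
proof -
  have "cl A \<subseteq> W" if "finite A" "A \<subseteq> W" for A
    using that
  proof (induction A)
    case empty
    then show ?case using loopless by simp
  next
    case (insert x A)
    have x: "x \<in> W" "x \<in> E" and A: "A \<subseteq> E" "cl A \<subseteq> W" using insert W by auto
    show ?case
    proof
      fix z assume z: "z \<in> cl (insert x A)"
      have zE: "z \<in> E" using z by (rule in_cl_ground)
      show "z \<in> W"
      proof (cases "x \<in> cl A \<or> z \<in> cl {x}")
        case True
        then show ?thesis
        proof
          assume "x \<in> cl A"
          then have "z \<in> cl A" using in_cl_cl[OF z] cl_superset[OF A(1)] by blast
          then show ?thesis using A by blast
        next
          assume "z \<in> cl {x}"
          then show ?thesis using lines[of x x] x by auto
        qed
      next
        case False
        \<comment> \<open>The line through \<open>z\<close> and \<open>x\<close> has rank 2 but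
          raises the rank of \<open>A\<close> by only 1, so it meets \<open>cl A\<close>.\<close>
        have "A \<union> {z, x} \<subseteq> cl (insert x A)"
          using z x A cl_superset[of "insert x A"] by auto
        then have "r (A \<union> {z, x}) \<le> r (cl (insert x A))" by (rule rank_mono)
        also have "\<dots> = r (insert x A)" using x A by (intro rank_cl) simp
        also have "\<dots> = Suc (r A)" using rank_insert[OF x(2)] False by simp
        finally have "r (A \<union> {z, x}) < r A + r {z, x}"
          using rank_pair[OF zE x(2)] False by simp
        then obtain u where u: "u \<in> cl A" "u \<in> cl {z, x}"
          using meet[of A "{z, x}"] A zE x by auto
        \<comment> \<open>If \<open>u\<close> were parallel to \<open>x\<close>, then
          \<open>x\<close> would lie in \<open>cl A\<close>.\<close>
        have "u \<notin> cl {x}"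
          using False cl_singleton_sym[of u x] x in_cl_cl[of x "{u}" A] u by blast
        then have "z \<in> cl {u, x}" using cl_exchange[OF u(2)] zE by simp
        then show ?thesis using lines[of u x] u A x by blast
      qed
    qed
  qed
  then have "cl W \<subseteq> W" using finite_subset[OF W finite_E] by blast
  then show ?thesis unfolding matroid_flat_def using W cl_superset by blast
qed


lemma exchange_line: "x \<in> cl {u, v} \<Longrightarrow> x \<notin> cl {u} \<Longrightarrow> v \<in> E \<Longrightarrow> v \<in> cl {u, x}"
  using cl_exchange[of x v "{u}"] by (simp add: insert_commute)

lemma exchange_line_flat:
  "x \<in> cl {u, v} \<Longrightarrow> x \<notin> cl {u} \<Longrightarrow> v \<in> E \<Longrightarrow> flat G \<Longrightarrow> u \<in> G \<Longrightarrow> x \<in> G \<Longrightarrow> v \<in> G"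
  using exchange_line[of x u v] in_cl_flat[of v "{u, x}" G] by simp

lemma in_cl_singleton_flat: "x \<in> cl {u} \<Longrightarrow> u \<in> E \<Longrightarrow> flat G \<Longrightarrow> x \<in> G \<Longrightarrow> u \<in> G"
  using cl_singleton_sym[of x u] in_cl_flat[of u "{x}" G] by simp

end

section \<open>The main case: two points off the hyperplane with the second colour\<close>

text \<open>The point \<open>p\<close>, where the line of \<open>y\<close> and \<open>z\<close>
  meets \<open>H\<close>, lies outside \<open>K\<close> and so has colour \<open>a\<close>.
  Peelability is assumed only up to rank 3, since all flats peeled below are planes or
  smaller.\<close>

locale peeling_configuration = projective_matroid M
  for M :: "'a set_system" +
  fixes c :: "'a \<Rightarrow> 'c" and F H K :: "'a set" and a b :: 'c and y z p :: 'a
  assumes flat_F: "flat F" and flat_H: "flat H" and flat_K: "flat K"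
    and HF: "H \<subseteq> F" and rank_F: "r F = Suc (r H)"
    and colour_H: "\<And>h. h \<in> H \<Longrightarrow> h \<notin> K \<Longrightarrow> c h = a"
    and ab: "a \<noteq> b" and yF: "y \<in> F" and zF: "z \<in> F" and yH: "y \<notin> H" and zH: "z \<notin> H"
    and cy: "c y = b" and cz: "c z = b" and zy: "z \<notin> cl {y}"
    and rank_H: "2 \<le> r H" and pH: "p \<in> H" and pL: "p \<in> cl {y, z}" and pK: "p \<notin> K"
    and small: "\<And>G. flat G \<Longrightarrow> G \<subseteq> F \<Longrightarrow> G \<noteq> {} \<Longrightarrow> r G \<le> 3 \<Longrightarrow> peelable c G"
begin

lemma FE: "x \<in> F \<Longrightarrow> x \<in> E"
  using flat_ground[OF flat_F] by blast

abbreviation "L \<equiv> cl {y, z}"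
abbreviation "plane x \<equiv> cl {x, y, z}"

lemma LF: "L \<subseteq> F"
  using cl_subset_flat[OF flat_F] yF zF by simp

lemma in_L: "y \<in> L" "z \<in> L"
  using cl_superset[of "{y, z}"] FE yF zF by auto

lemma in_plane: "x \<in> F \<Longrightarrow> x \<in> plane x"
  using cl_superset[of "{x, y, z}"] FE yF zF by auto

lemma L_plane: "L \<subseteq> plane x"
  by (rule cl_mono) auto

lemma plane_F: "x \<in> F \<Longrightarrow> plane x \<subseteq> F"
  using cl_subset_flat[OF flat_F] yF zF by simp

lemma plane_subset: "w \<in> plane x \<Longrightarrow> plane w \<subseteq> plane x"
  using cl_subset_flat[OF flat_cl, of "{w, y, z}"] L_plane[of x] in_L by auto

text \<open>With \<open>plane_subset\<close> this shows that the planes through \<open>L\<close>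
  partition the points of \<open>F\<close> off \<open>L\<close>.\<close>

lemma plane_exchange: "w \<in> plane x \<Longrightarrow> w \<notin> L \<Longrightarrow> x \<in> F \<Longrightarrow> x \<in> plane w"
  using cl_exchange[of w x "{y, z}"] FE by simp

lemma rank_plane: "x \<in> F \<Longrightarrow> x \<notin> L \<Longrightarrow> r {x, y, z} = 3"
  using rank_insert[of x "{y, z}"] rank_pair[of z y] zy FE yF zF by (simp add: insert_commute)

text \<open>This supplies each plane through \<open>L\<close> with a point off \<open>L\<close> of
  colour \<open>a\<close>. The line from \<open>y\<close> to \<open>x\<close> meets the hyperplane
  \<open>H\<close> in a point \<open>u\<close> off \<open>L\<close>, which serves unless it lies in
  \<open>K\<close>.\<close>

lemma hyperplane_point:
  assumes x: "x \<in> F" "x \<notin> L"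
  shows "\<exists>h. h \<in> H \<and> h \<in> plane x \<and> h \<notin> L \<and> h \<notin> K"
proof -
  have E: "x \<in> E" "y \<in> E" "p \<in> E" using x yF pH HF FE by auto
  have yx: "x \<notin> cl {y}" using x(2) cl_mono[of "{y}" "{y, z}"] by auto
  have "r (H \<union> {y, x}) \<le> r F" by (rule rank_mono) (use HF x yF in auto)
  then have "r (H \<union> {y, x}) < r H + r {y, x}"
    using rank_F rank_pair[OF E(1,2) yx] by (simp add: insert_commute)
  then obtain u where u: "u \<in> cl H" "u \<in> cl {y, x}"
    using meet[of H "{y, x}"] flat_ground[OF flat_H] E by auto
  have uH: "u \<in> H" using u(1) flat_H by (simp add: matroid_flat_def)
  then have uE: "u \<in> E" using HF FE by blast
  have "u \<notin> cl {y}" using in_cl_singleton_flat[of u y H] uH yH E flat_H by blast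
  then have uL: "u \<notin> L" using exchange_line_flat[OF u(2) _ E(1) flat_cl in_L(1)] x(2) by blast
  have uP: "u \<in> plane x" using u(2) cl_mono[of "{y, x}" "{x, y, z}"] by auto
  show ?thesis
  proof (cases "u \<in> K")
    case True
    \<comment> \<open>Replace \<open>u\<close> by a third point \<open>m\<close> of the line through
      \<open>p\<close> and \<open>u\<close>: \<open>m\<close> in \<open>L\<close> would force
      \<open>u\<close> into \<open>L\<close>, and \<open>m\<close> in \<open>K\<close> would force
      \<open>p\<close> into \<open>K\<close>.\<close>
    have pu: "p \<notin> cl {u}" using in_cl_flat[OF _ flat_K] True pK by blast
    then obtain m where m: "m \<in> cl {p, u}" "m \<notin> cl {p}" "m \<notin> cl {u}"
      using third_point[OF E(3) uE] by blast
    have "m \<notin> L" using exchange_line_flat[OF m(1,2) uE flat_cl pL] uL by blast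
    moreover have "m \<notin> K"
      using exchange_line_flat[of m u p K] m E True flat_K pK by (auto simp: insert_commute)
    moreover have "m \<in> H" using in_cl_flat[OF m(1) flat_H] pH uH by blast
    moreover have "m \<in> plane x" using in_cl_flat[OF m(1) flat_cl] pL L_plane uP by blast
    ultimately show ?thesis by blast
  qed (use uH uL uP in blast)
qed

text \<open>Let \<open>G\<close> peel the plane. Whether \<open>G\<close> contains both
  \<open>y\<close> and \<open>z\<close> decides the colour of the peeled layer.\<close>

lemma plane_dichotomy:
  assumes x: "x \<in> F" "x \<notin> L"
  shows "(\<forall>w\<in>plane x - L. c w = a) \<or> (\<forall>w\<in>plane x - H. c w = b)"
proof -
  obtain h where h: "h \<in> H" "h \<in> plane x" "h \<notin> L" "h \<notin> K"
    using hyperplane_point[OF x] by blast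
  have ch: "c h = a" and cp: "c p = a" using colour_H h pH pK by auto
  have E: "{x, y, z} \<subseteq> E" "h \<in> E" "p \<in> E" using x yF zF h pH HF FE by auto
  have rP: "r (plane x) = 3" using rank_cl[OF E(1)] rank_plane[OF x] by simp
  then obtain G where G: "flat G" "G \<subset> plane x" "monochromatic c (plane x - G)"
    using small[of "plane x"] flat_cl plane_F[OF x(1)] in_plane[OF x(1)]
    unfolding peelable_def by auto
  then obtain d where d: "\<And>w. w \<in> plane x \<Longrightarrow> w \<notin> G \<Longrightarrow> c w = d"
    unfolding monochromatic_def by auto
  have yP: "y \<in> plane x" "z \<in> plane x" "p \<in> plane x" using L_plane[of x] in_L pL by auto
  show ?thesis
  proof (cases "y \<in> G \<and> z \<in> G")
    case True
    \<comment> \<open>Containing \<open>L\<close> and being proper, \<open>G\<close> has no point of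
      the plane off \<open>L\<close>; so the layer contains \<open>h\<close> and has colour
      \<open>a\<close>.\<close>
    have out: "w \<notin> G" if w: "w \<in> plane x" "w \<notin> L" for w
    proof
      assume "w \<in> G"
      then have "x \<in> G"
        using in_cl_flat[OF plane_exchange[OF w x(1)] G(1)] True by simp
      then show False using cl_subset_flat[OF G(1), of "{x, y, z}"] True G(2) by blast
    qed
    then have "d = a" using d h ch by blast
    then show ?thesis using d out by blast
  next
    case False
    \<comment> \<open>Now \<open>y\<close> or \<open>z\<close> is in the layer, so \<open>h\<close>
      and \<open>p\<close>, of colour \<open>a\<close>, lie in \<open>G\<close>. They span a line
      inside \<open>H\<close>, so one more point of \<open>G\<close> off \<open>H\<close> would make
      \<open>G\<close> the whole plane.\<close>
    then have db: "d = b" using d yP cy cz by blast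
    then have pG: "p \<in> G" "h \<in> G" using d yP h ch cp ab by metis+
    have "w \<notin> G" if w: "w \<in> plane x" "w \<notin> H" for w
    proof
      assume "w \<in> G"
      then have "r {w, h, p} \<le> r G" using pG by (intro rank_mono) simp
      moreover have "h \<notin> cl {p}" using in_cl_flat[OF _ flat_cl, of h "{p}"] pL h by blast
      then have "r {h, p} = 2" using rank_pair[OF E(2,3)] by simp
      moreover have "w \<notin> cl {h, p}" using in_cl_flat[OF _ flat_H] h pH w by blast
      moreover have "w \<in> E" using w in_cl_ground by blast
      ultimately have "3 \<le> r G" using rank_insert[of w "{h, p}"] by simp
      then show False using flat_psubset_rank[OF G(1) flat_cl G(2)] rP by simp
    qed
    then show ?thesis using d db by blast
  qed
qed

text \<open>A third point of the line through \<open>y\<close> and \<open>h\<close> avoids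
  \<open>H\<close>, since together with \<open>h\<close> it spans \<open>y\<close>.\<close>

lemma third_point_off_H:
  assumes h: "h \<in> H"
  shows "\<exists>u. u \<in> cl {y, h} \<and> u \<notin> H \<and> u \<notin> cl {y}"
proof -
  have E: "y \<in> E" "h \<in> E" using h yF HF FE by auto
  have "y \<notin> cl {h}" using in_cl_flat[OF _ flat_H] h yH by blast
  then obtain u where u: "u \<in> cl {y, h}" "u \<notin> cl {y}" "u \<notin> cl {h}"
    using third_point[OF E] by blast
  then have "u \<notin> H"
    using exchange_line_flat[of u h y H] E h flat_H yH by (auto simp: insert_commute)
  then show ?thesis using u by blast
qed

text \<open>The union of \<open>L\<close> and the planes through \<open>L\<close> not of the first
  kind in \<open>plane_dichotomy\<close>. Stated by negation, it makes every point of
  \<open>F\<close> outside \<open>W\<close> have colour \<open>a\<close> at once.\<close>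

definition W :: "'a set" where
  "W = {x \<in> F. x \<in> L \<or> \<not> (\<forall>w\<in>plane x - L. c w = a)}"

text \<open>Otherwise \<open>plane x\<close> would lie inside \<open>plane t\<close> and have colour
  \<open>a\<close> off \<open>L\<close>, contrary to \<open>x \<in> W\<close>.\<close>

lemma plane_not_a:
  assumes x: "x \<in> W" "x \<notin> L" and t: "\<forall>w\<in>plane t - L. c w = a"
  shows "x \<notin> plane t"
  using assms plane_subset[of x t] unfolding W_def by blast

lemma coplanar_case:
  assumes t: "\<forall>w\<in>plane t - L. c w = a" "t \<notin> L" and x: "x \<in> W" "x \<notin> L"
  shows "t \<notin> plane x"
  using plane_exchange[of t x] plane_not_a[OF x t(1)] x t(2) unfolding W_def by blast

text \<open>If \<open>W\<close> missed a point \<open>t\<close> of the line through \<open>x1\<close> and \<open>x2\<close>, then a plane through \<open>y\<close> that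
  meets \<open>L\<close> only there would cut the planes \<open>plane x1\<close>, \<open>plane x2\<close>, \<open>plane t\<close> in lines containing
  spanning triples of colour \<open>b\<close> (\<open>y, u1, u2\<close>) and of colour \<open>a\<close> (\<open>h1, t1, t2\<close>), so that plane is not
  peelable.\<close>

lemma W_closed_under_lines:
  assumes x1: "x1 \<in> W" and x2: "x2 \<in> W"
  shows "cl {x1, x2} \<subseteq> W"
proof (rule ccontr)
  assume "\<not> cl {x1, x2} \<subseteq> W"
  then obtain t where t: "t \<in> cl {x1, x2}" "t \<notin> W" by blast
  have xF: "x1 \<in> F" "x2 \<in> F" using x1 x2 unfolding W_def by auto
  have tF: "t \<in> F" using in_cl_flat[OF t(1) flat_F] xF by simp
  have tL: "t \<notin> L" and ta: "\<forall>w\<in>plane t - L. c w = a" using t(2) tF unfolding W_def by auto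
  have span: "t \<in> plane x" if "x1 \<in> plane x" "x2 \<in> plane x" for x
    using in_cl_flat[OF t(1) flat_cl] that by blast
  \<comment> \<open>If \<open>x1\<close> were on \<open>L\<close>, then \<open>plane x2\<close>
    would contain both points and hence \<open>t\<close>.\<close>
  have L1: "x1 \<notin> L"
  proof
    assume *: "x1 \<in> L"
    then have "x2 \<notin> L" using in_cl_flat[OF t(1) flat_cl] tL by blast
    then show False
      using coplanar_case[OF ta tL x2] span[of x2] in_plane[OF xF(2)] L_plane[of x2] * by blast
  qed
  have x21: "x2 \<notin> plane x1"
    using coplanar_case[OF ta tL x1 L1] span[of x1] in_plane[OF xF(1)] by blast
  then have L2: "x2 \<notin> L" using L_plane[of x1] by blast
  have x12: "x1 \<notin> plane x2" using plane_exchange[OF _ L1 xF(2)] x21 by blast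
  have B: "c w = b" if "x = x1 \<or> x = x2" "w \<in> plane x" "w \<notin> H" for x w
    using plane_dichotomy[of x] that x1 x2 L1 L2 unfolding W_def by blast
  obtain h1 where h1: "h1 \<in> H" "h1 \<in> plane x1" "h1 \<notin> L" "h1 \<notin> K"
    using hyperplane_point[OF xF(1) L1] by blast
  obtain h2 where h2: "h2 \<in> H" "h2 \<in> plane x2" "h2 \<notin> L" "h2 \<notin> K"
    using hyperplane_point[OF xF(2) L2] by blast
  have E: "x1 \<in> E" "x2 \<in> E" "y \<in> E" "z \<in> E" "h1 \<in> E" "h2 \<in> E" "t \<in> E"
    using xF yF zF h1 h2 HF tF FE by auto
  have x1h1: "x1 \<in> plane h1" using plane_exchange[OF h1(2,3) xF(1)] .
  have h12: "h1 \<notin> plane x2" using plane_subset[of h1 x2] x1h1 x12 by blast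
  have h1t: "h1 \<notin> plane t" using plane_subset[of h1 t] x1h1 plane_not_a[OF x1 L1 ta] by blast
  \<comment> \<open>The line of \<open>h1\<close> and \<open>h2\<close> and the plane of
    \<open>t\<close> lie in a flat of rank at most 4, while their ranks add up to 5; hence they
    meet, in \<open>t1\<close>.\<close>
  have "r ({h1, h2} \<union> {t, y, z}) \<le> r (cl {x1, x2, y, z})"
  proof (rule rank_mono)
    have "plane x1 \<subseteq> cl {x1, x2, y, z}" "plane x2 \<subseteq> cl {x1, x2, y, z}"
      "cl {x1, x2} \<subseteq> cl {x1, x2, y, z}" by (rule cl_mono, blast)+
    then show "{h1, h2} \<union> {t, y, z} \<subseteq> cl {x1, x2, y, z}"
      using h1 h2 t in_L L_plane[of x1] by blast
  qed
  also have "\<dots> = r {x1, x2, y, z}" using E by (intro rank_cl) simp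
  also have "\<dots> \<le> 4"
    using rank_insert_le[of x1 "{x2, y, z}"] rank_plane[OF xF(2) L2] by simp
  finally have "r ({h1, h2} \<union> {t, y, z}) \<le> 4" .
  moreover have "h1 \<notin> cl {h2}" using in_cl_flat[OF _ flat_cl] h12 h2 by blast
  then have "r {h1, h2} = 2" using rank_pair E by simp
  moreover note rank_plane[OF tF tL]
  ultimately obtain t1 where t1: "t1 \<in> cl {h1, h2}" "t1 \<in> plane t"
    using meet[of "{h1, h2}" "{t, y, z}"] E by auto
  have t1H: "t1 \<in> H" using in_cl_flat[OF t1(1) flat_H] h1 h2 by simp
  \<comment> \<open>If \<open>t1\<close> were on \<open>L\<close>, then \<open>plane x2\<close>
    would contain \<open>h2\<close> and \<open>t1\<close>, hence also \<open>h1\<close>.\<close>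
  have t1L: "t1 \<notin> L"
  proof
    assume *: "t1 \<in> L"
    then have "t1 \<notin> cl {h2}" using in_cl_singleton_flat[OF _ E(6) flat_cl] h2 by blast
    then show False
      using exchange_line_flat[of t1 h2 h1 "plane x2"] t1(1) E(5) flat_cl h2(2) h12 * L_plane
      by (auto simp: insert_commute)
  qed
  \<comment> \<open>Off \<open>H\<close>, the points \<open>u1\<close> and \<open>u2\<close> get
    colour \<open>b\<close> from their planes; \<open>t2\<close> lies in \<open>plane t\<close> off
    \<open>L\<close> and so gets colour \<open>a\<close>.\<close>
  obtain u1 where u1: "u1 \<in> cl {y, h1}" "u1 \<notin> H" "u1 \<notin> cl {y}" using third_point_off_H h1 by blast
  obtain u2 where u2: "u2 \<in> cl {y, h2}" "u2 \<notin> H" "u2 \<notin> cl {y}" using third_point_off_H h2 by blast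
  obtain t2 where t2: "t2 \<in> cl {y, t1}" "t2 \<notin> H" "t2 \<notin> cl {y}" using third_point_off_H t1H by blast
  have yP: "y \<in> plane x" for x using in_L L_plane by blast
  have cu: "c u1 = b" "c u2 = b"
    using B[of x1 u1] B[of x2 u2] in_cl_flat[OF u1(1) flat_cl] in_cl_flat[OF u2(1) flat_cl]
      u1 u2 h1 h2 yP by auto
  have t2T: "t2 \<in> plane t" using in_cl_flat[OF t2(1) flat_cl] yP t1 by simp
  have t1E: "t1 \<in> E" using t1 in_cl_ground by blast
  have "t2 \<notin> L" using exchange_line_flat[OF t2(1,3) t1E flat_cl in_L(1)] t1L by blast
  then have ct: "c t1 = a" "c t2 = a" "c h1 = a" using ta t1 t1L t2T colour_H h1 by auto
  let ?R = "cl {y, h1, h2}"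
  have R: "{y, h1, h2} \<subseteq> ?R" using E by (intro cl_superset) simp
  have RF: "?R \<subseteq> F" by (rule cl_subset_flat[OF flat_F]) (use yF h1 h2 HF in auto)
  have "r ?R = r {y, h1, h2}" using E by (intro rank_cl) simp
  also have "\<dots> \<le> 3" using rank_insert_le[of y "{h1, h2}"] \<open>r {h1, h2} = 2\<close> by simp
  finally obtain G where G: "flat G" "G \<subset> ?R" "monochromatic c (?R - G)"
    using small[OF flat_cl RF] R unfolding peelable_def by auto
  have G': "\<not> {y, h1, h2} \<subseteq> G" using cl_subset_flat[OF G(1)] G(2) by blast
  from G obtain d where d: "\<And>w. w \<in> ?R \<Longrightarrow> w \<notin> G \<Longrightarrow> c w = d"
    unfolding monochromatic_def by auto
  have t1R: "t1 \<in> ?R" using in_cl_flat[OF t1(1) flat_cl] R by simp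
  have inR: "u1 \<in> ?R" "u2 \<in> ?R" "t2 \<in> ?R"
    using in_cl_flat[OF u1(1) flat_cl] in_cl_flat[OF u2(1) flat_cl] in_cl_flat[OF t2(1) flat_cl]
      R t1R by auto
  show False
  \<comment> \<open>The points whose colour differs from that of the layer lie in \<open>G\<close>.
    In the first case \<open>y\<close>, \<open>u1\<close>, \<open>u2\<close> span \<open>h1\<close>
    and \<open>h2\<close>; in the second \<open>t1\<close>, \<open>t2\<close> span \<open>y\<close>
    and \<open>h1\<close>, \<open>t1\<close> span \<open>h2\<close>. Either way \<open>G\<close> is
    all of \<open>?R\<close>.\<close>
  proof (cases "d = a")
    case True
    then have g: "y \<in> G" "u1 \<in> G" "u2 \<in> G" using d inR R cu cy ab by (metis insert_subset)+
    then have "h1 \<in> G" "h2 \<in> G"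
      using exchange_line_flat[OF u1(1,3) E(5) G(1)] exchange_line_flat[OF u2(1,3) E(6) G(1)] by auto
    then show False using G' g by simp
  next
    case False
    then have g: "h1 \<in> G" "t1 \<in> G" "t2 \<in> G" using d inR t1R R ct by (metis insert_subset)+
    have "t2 \<notin> cl {t1}" using in_cl_flat[OF _ flat_H] t1H t2(2) by blast
    then have "y \<in> G"
      using exchange_line_flat[of t2 t1 y G] t2(1) E(3) G(1) g by (simp add: insert_commute)
    moreover have "t1 \<notin> cl {h1}" using in_cl_singleton_flat[OF _ E(5) flat_cl t1(2)] h1t by blast
    then have "h2 \<in> G" using exchange_line_flat[OF t1(1) _ E(6) G(1) g(1,2)] by blast
    ultimately show False using G' g by simp
  qed
qed

lemma peelable_F: "peelable c F"
proof (cases "W = F")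
  case True
  have B: "c w = b" if "x \<in> F" "x \<notin> L" "w \<in> plane x" "w \<notin> H" for x w
    using plane_dichotomy[of x] that True unfolding W_def by blast
  have "r L = 2"
    using rank_cl[of "{y, z}"] rank_pair[of z y] zy FE yF zF by (simp add: insert_commute)
  then have "L \<noteq> F" using rank_F rank_H by auto
  \<comment> \<open>The points of \<open>L\<close> off \<open>H\<close> need some plane through
    \<open>L\<close> to give them colour \<open>b\<close>; it exists because \<open>F\<close> has
    rank at least 3.\<close>
  then obtain x0 where x0: "x0 \<in> F" "x0 \<notin> L" using LF by blast
  have "c x = b" if "x \<in> F" "x \<notin> H" for x
    using B[OF x0, of x] B[of x x] in_plane[of x] L_plane[of x0] that by blast
  then show ?thesis
    unfolding peelable_def monochromatic_def using flat_H HF yF yH by blast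
next
  case False
  have "flat W"
    using W_closed_under_lines flat_ground[OF flat_F]
    by (intro flat_if_closed_under_lines) (auto simp: W_def)
  moreover have "c x = a" if "x \<in> F - W" for x
    using that in_plane[of x] unfolding W_def by blast
  moreover have "W \<subset> F" using False unfolding W_def by auto
  ultimately show ?thesis unfolding peelable_def monochromatic_def by blast
qed

end

section \<open>Induction on the rank of the flat\<close>

context projective_matroid
begin

lemma peelable_step:
  assumes F: "flat F" "4 \<le> r F"
    and small: "\<And>G. flat G \<Longrightarrow> G \<subseteq> F \<Longrightarrow> G \<noteq> {} \<Longrightarrow> r G < r F \<Longrightarrow> peelable c G"
  shows "peelable c F"
proof -
  obtain H where H: "flat H" "H \<subset> F" "Suc (r H) = r F" using hyperplane_ex[OF F(1)] F(2) by auto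
  have "H \<noteq> {}" using H(3) F(2) rank_empty by auto
  then obtain K where K: "flat K" "K \<subset> H" "monochromatic c (H - K)"
    using small[OF H(1)] H unfolding peelable_def by auto
  then obtain a where a: "\<And>h. h \<in> H \<Longrightarrow> h \<notin> K \<Longrightarrow> c h = a" unfolding monochromatic_def by auto
  have FE: "\<And>x. x \<in> F \<Longrightarrow> x \<in> E" using flat_ground[OF F(1)] by blast
  have KE: "insert x K \<subseteq> E" if "x \<in> F" for x using FE that K H by auto
  show ?thesis
  \<comment> \<open>If no such pair exists, then either some point \<open>y\<close> off
    \<open>H\<close> is not of colour \<open>a\<close> and \<open>cl (insert y K)\<close> contains
    all other such points, or \<open>F - H\<close> has colour \<open>a\<close>.\<close>
  proof (cases "\<exists>y z. y \<in> F \<and> z \<in> F \<and> y \<notin> H \<and> z \<notin> H \<and> c y \<noteq> a \<and> c z \<noteq> a \<and> z \<notin> cl (insert y K)")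
    case True
    then obtain y z where yz: "y \<in> F" "z \<in> F" "y \<notin> H" "z \<notin> H" "c y \<noteq> a" "c z \<noteq> a"
      "z \<notin> cl (insert y K)" by blast
    have E: "y \<in> E" "z \<in> E" using yz FE by auto
    have zy: "z \<notin> cl {y}" using yz(7) cl_mono[of "{y}" "insert y K"] by auto
    have r2: "r {y, z} = 2" using rank_pair[OF E(2,1) zy] by (simp add: insert_commute)
    have "r (H \<union> {y, z}) \<le> r F" by (rule rank_mono) (use H yz in auto)
    then obtain p where p: "p \<in> cl H" "p \<in> cl {y, z}"
      using meet[of H "{y, z}"] flat_ground[OF H(1)] E H(3) r2 by auto
    have pH: "p \<in> H" using p(1) H(1) by (simp add: matroid_flat_def)
    have py: "p \<notin> cl {y}" using in_cl_singleton_flat[OF _ E(1) H(1) pH] yz by blast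
    have pz: "p \<notin> cl {z}" using in_cl_singleton_flat[OF _ E(2) H(1) pH] yz by blast
    have yK: "insert y K \<subseteq> cl (insert y K)" by (rule cl_superset[OF KE[OF yz(1)]])
    \<comment> \<open>With \<open>p\<close> in \<open>K\<close>, the points \<open>p\<close> and
      \<open>y\<close> would put \<open>z\<close> into \<open>cl (insert y K)\<close>.\<close>
    have pK: "p \<notin> K"
      using exchange_line_flat[OF p(2) py E(2) flat_cl, of "insert y K"] yK yz by blast
    have cp: "c p = a" using a pH pK by blast
    let ?L = "cl {y, z}"
    have LF: "?L \<subseteq> F" using cl_subset_flat[OF F(1)] yz by simp
    have yL: "{y, z} \<subseteq> ?L" using E by (intro cl_superset) simp
    have "r ?L = 2" using rank_cl[of "{y, z}"] E r2 by simp
    then obtain G where G: "flat G" "G \<subset> ?L" "monochromatic c (?L - G)"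
      using small[OF flat_cl LF] yL F(2) unfolding peelable_def by auto
    \<comment> \<open>A proper flat of the line contains at most one of the points \<open>y\<close>,
      \<open>z\<close>, \<open>p\<close>. If it contained \<open>y\<close>, the layer would hold
      \<open>z\<close> and \<open>p\<close> and give \<open>z\<close> colour \<open>a\<close>;
      likewise for \<open>z\<close>. So \<open>y\<close> and \<open>z\<close> share the layer and
      its colour.\<close>
    have "\<not> {y, z} \<subseteq> G" using cl_subset_flat[OF G(1)] G(2) by blast
    moreover have "p \<notin> G" if "y \<in> G"
      using exchange_line_flat[OF p(2) py E(2) G(1) that] that calculation by blast
    moreover have "p \<notin> G" if "z \<in> G"
      using exchange_line_flat[of p z y G] p(2) pz E(1) G(1) that calculation
      by (auto simp: insert_commute)
    moreover from G obtain d where d: "\<And>w. w \<in> ?L \<Longrightarrow> w \<notin> G \<Longrightarrow> c w = d"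
      unfolding monochromatic_def by auto
    ultimately have "y \<notin> G" "z \<notin> G" using yL p(2) cp yz by (metis insert_subset empty_subsetI)+
    then have cz: "c z = c y" using d yL by (metis insert_subset)
    interpret peeling_configuration M c F H K a "c y" y z p
      by unfold_locales (use F H K a yz cz zy pH p pK small in auto)
    show ?thesis by (rule peelable_F)
  next
    case False
    show ?thesis
    proof (cases "\<exists>y. y \<in> F \<and> y \<notin> H \<and> c y \<noteq> a")
      case True
      then obtain y where y: "y \<in> F" "y \<notin> H" "c y \<noteq> a" by blast
      let ?G = "cl (insert y K)"
      have "r ?G = r (insert y K)" by (rule rank_cl[OF KE[OF y(1)]])
      also have "\<dots> \<le> Suc (r K)" by (rule rank_insert_le)
      \<comment> \<open>As \<open>K\<close> is a proper flat of \<open>H\<close>, one added point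
        brings its rank to at most \<open>r H\<close>.\<close>
      finally have "r ?G < r F" using flat_psubset_rank[OF K(1) H(1) K(2)] H(3) by simp
      then have "?G \<noteq> F" by auto
      moreover have "?G \<subseteq> F" using cl_subset_flat[OF F(1)] y K H by auto
      moreover have "c x = a" if "x \<in> F - ?G" for x
        using that False y a[of x] cl_superset[OF KE[OF y(1)]] by blast
      ultimately show ?thesis
        unfolding peelable_def monochromatic_def using flat_cl by blast
    next
      case False
      then show ?thesis
        unfolding peelable_def monochromatic_def using H by blast
    qed
  qed
qed

lemma peelable_if_rank_le_3:
  assumes small: "\<And>G. flat G \<Longrightarrow> G \<noteq> {} \<Longrightarrow> r G \<le> 3 \<Longrightarrow> peelable c G"
  shows "flat F \<Longrightarrow> F \<noteq> {} \<Longrightarrow> peelable c F"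
proof (induction "r F" arbitrary: F rule: less_induct)
  case less
  show ?case
  proof (cases "r F \<le> 3")
    case False
    then have "4 \<le> r F" by simp
    from peelable_step[OF less.prems(1) this] show ?thesis using less.hyps by blast
  qed (use small less.prems in blast)
qed

end

section \<open>Connected modular matroids as projective geometries\<close>

context finite_matroid
begin

text \<open>Extend a basis of \<open>F\<close> to a basis of \<open>M\<close> and close up a
  three-element set in between.\<close>

lemma plane_containing:
  assumes "flat F" "r F \<le> 3" "3 \<le> r E"
  shows "\<exists>P. matroid_plane M P \<and> F \<subseteq> P"
proof -
  obtain B where B: "B \<subseteq> F" "ind B" "card B = r F" using basis_ex by blast
  obtain B' where B': "B \<subseteq> B'" "B' \<subseteq> E" "ind B'" "card B' = r E"
    using basis_extend[OF B(2) ind_ground[OF B(2)]] by blast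
  obtain X where X: "B \<subseteq> X" "X \<subseteq> B'" "card X = 3"
    using exists_subset_between[of B 3 B'] B B' assms ind_finite[OF B'(3)] by auto
  have indX: "ind X" using ind_subset[OF B'(3) X(2)] .
  have "r (cl X) = 3" using rank_cl[OF ind_ground[OF indX]] rank_ind[OF indX] X by simp
  then have "matroid_plane M (cl X)" unfolding matroid_plane_def using flat_cl by simp
  moreover have "cl B = F"
    using cl_subset_flat[OF assms(1) B(1)] rank_cl[OF ind_ground[OF B(2)]] rank_ind[OF B(2)] B
    by (intro flat_eqI flat_cl assms) auto
  then have "F \<subseteq> cl X" using cl_mono[OF X(1)] by simp
  ultimately show ?thesis by blast
qed

text \<open>Rank at least 2 gives a second element; a circuit through it and a loop would have the
  loop as an independent proper subset.\<close>

lemma connected_loopless: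
  assumes "matroid_connected M" "2 \<le> r E"
  shows "cl {} = {}"
proof (rule ccontr)
  assume "cl {} \<noteq> {}"
  then obtain e where e: "e \<in> cl {}" by blast
  then have eE: "e \<in> E" by (rule in_cl_ground)
  have "r {e} = 0" using e rank_empty by (simp add: matroid_cl_def)
  then have "E \<noteq> {e}" using assms(2) by auto
  then obtain f where f: "f \<in> E" "f \<noteq> e" using eE by blast
  then obtain C where C: "matroid_circuit M C" "e \<in> C" "f \<in> C"
    using assms(1) eE unfolding matroid_connected_def by blast
  then have "ind {e}" using f unfolding matroid_circuit_def by blast
  then show False using rank_ind \<open>r {e} = 0\<close> by fastforce
qed

text \<open>Take a circuit \<open>C\<close> through \<open>u\<close> and \<open>v\<close>. Since
  \<open>r C < card C\<close>, the line of \<open>u\<close> and \<open>v\<close> meets the closure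
  of \<open>C - {u, v}\<close> in a point \<open>m\<close>. If \<open>m\<close> were parallel to
  \<open>u\<close>, that closure would contain \<open>u\<close>, although \<open>C - {v}\<close> is
  independent; likewise for \<open>v\<close>.\<close>

lemma connected_modular_third_point:
  assumes conn: "matroid_connected M" and mod: "matroid_modular M" and loopless: "cl {} = {}"
    and uv: "u \<in> E" "v \<in> E" "u \<notin> cl {v}"
  shows "\<exists>m\<in>cl {u, v}. m \<notin> cl {u} \<and> m \<notin> cl {v}"
proof -
  have "v \<in> cl {v}" using cl_superset[of "{v}"] uv by simp
  then have ne: "u \<noteq> v" using uv by blast
  then obtain C where C: "matroid_circuit M C" "u \<in> C" "v \<in> C"
    using conn uv unfolding matroid_connected_def by blast
  have CE: "C \<subseteq> E" and nC: "\<not> ind C" and sub: "\<And>D. D \<subset> C \<Longrightarrow> ind D"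
    using C(1) unfolding matroid_circuit_def by auto
  have fin: "finite C" using CE finite_E by (rule finite_subset)
  let ?C = "C - {u, v}"
  have cC: "card C = card ?C + 2" using C ne fin card_Diff_subset[of "{u, v}" C]
      card_mono[OF fin, of "{u, v}"] by simp
  have "ind ?C" using sub[of ?C] C by blast
  then have rC: "r ?C = card ?C" by (rule rank_ind)
  obtain B where B: "B \<subseteq> C" "ind B" "card B = r C" using basis_ex by blast
  then have "r C < card C" using nC psubset_card_mono[OF fin, of B] by (metis psubsetI)
  moreover have "r {u, v} = 2"
    using rank_insert[of u "{v}"] rank_insert[of v "{}"] uv loopless rank_empty by simp
  moreover have "?C \<union> {u, v} = C" using C by blast
  ultimately obtain m where m: "m \<in> cl ?C" "m \<in> cl {u, v}"
    using modular_meet[OF mod, of ?C "{u, v}"] CE uv rC cC by auto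
  have "m \<notin> cl {w}" if w: "w = u \<or> w = v" for w
  proof
    assume "m \<in> cl {w}"
    then have "w \<in> cl {m}" using cl_exchange[of m w "{}"] loopless w uv by auto
    then have "w \<in> cl ?C" using in_cl_cl[of w "{m}"] m(1) by simp
    then have "r (insert w ?C) = r ?C" by (simp add: matroid_cl_def)
    moreover have "insert w ?C \<subset> C" using w C ne by auto
    then have "ind (insert w ?C)" by (rule sub)
    then have "r (insert w ?C) = card (insert w ?C)" by (rule rank_ind)
    moreover have "card (insert w ?C) = Suc (card ?C)" using w fin by auto
    ultimately show False using rC by simp
  qed
  then show ?thesis using m(2) by blast
qed

end

theorem theorem7p8:
  fixes M :: "'a set_system" and c :: "'a \<Rightarrow> 'c"
  assumes "matroid M"
    and "matroid_connected M"
    and "matroid_modular M"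
    and "matroid_rank M (ground M) \<ge> 3"
  shows "target M c \<longleftrightarrow>
    (\<forall>P. matroid_plane M P \<longrightarrow> target (matroid_restrict M P) (restrict c P))"
proof -
  interpret finite_matroid M by unfold_locales (rule assms(1))
  have loopless: "cl {} = {}" using connected_loopless assms by simp
  interpret projective_matroid M
    by unfold_locales (use loopless assms(3) connected_modular_third_point[OF assms(2,3) loopless] in auto)
  have flat_P: "flat P" if "matroid_plane M P" for P using that unfolding matroid_plane_def by blast
  \<comment> \<open>From right to left: every flat of rank at most 3 lies in a plane and so is
    peelable, and the induction on rank does the rest.\<close>
  have "(\<forall>F. flat F \<and> F \<noteq> {} \<longrightarrow> peelable c F) \<longleftrightarrow>
    (\<forall>P. matroid_plane M P \<longrightarrow> (\<forall>F. flat F \<and> F \<noteq> {} \<and> F \<subseteq> P \<longrightarrow> peelable c F))"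
    using peelable_if_rank_le_3[of c] plane_containing[OF _ _ assms(4)] by blast
  then show ?thesis
    using target_iff_peelable[OF loopless, of c] target_restrict_iff_peelable[OF loopless flat_P, of _ c]
    by blast
qed

end
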